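(* Let $D$ be a weighted oriented graph (in which, by convention, every source has weight $1$), let $G$ be its underlying graph, and let $I(D)\subset S=K[t_1,\ldots,t_s]$ be its edge ideal. Then $I(D)^2=I(D)^{(2)}$ if and only if the following two conditions hold: (i) every vertex in $V^+(D)$ is a sink; (ii) $G$ has no triangles.
   Context: Let $G$ be a finite simple graph with vertex set $\{t_1,\ldots,t_s\}$ and edge set $E(G)$. A weighted oriented graph $D$ with underlying graph $G$ is a triple $(V(D),E(D),w)$ where $V(D)=V(G)$, $E(D)\subset V(D)\times V(D)$ satisfies $E(G)=\{\{t_i,t_j\}\mid (t_i,t_j)\in E(D)\}$ and $|E(D)|=|E(G)|$ (so each edge of $G$ receives exactly one direction), and $w\colon V(D)\to\{1,2,3,\ldots\}$ is a weight function; write $w_i=w(t_i)$. The edge $(t_i,t_j)$ is directed from $t_i$ to $t_j$. A source is a vertex with only outgoing edges; a sink is a vertex with only incoming edges. Standing convention: every source of $D$ has weight $1$. Set $V^+(D)=\{t_i\in V(D)\mid w_i>1\}$. Let $K$ be a field and $S=K[t_1,\ldots,t_s]$, with the vertices regarded as variables. The edge ideal of $D$ is $I(D)=(\{t_it_j^{w_j}\mid (t_i,t_j)\in E(D)\})\subset S$. For $n\ge 1$, the $n$-th symbolic power of an ideal $I$ of $S$ is defined using the minimal primes: if $\mathfrak p_1,\ldots,\mathfrak p_r$ are the minimal primes of $I$, then $I^{(n)}=\bigcap_{i=1}^r (I^nS_{\mathfrak p_i}\cap S)$. A triangle of $G$ is a set of three pairwise adjacent vertices. *)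

theory Defs
  imports
    "HOL-Library.Poly_Mapping"
    "HOL-Computational_Algebra.Fraction_Field"
    "HOL-Algebra.Ideal_Product"
    "HOL-Algebra.Algebraic_Closure_Type"
begin

section \<open>Weighted oriented graphs\<close>

text \<open>
  The vertex set is the whole finite type \<open>'v\<close>; the vertices double as the variables of
  the polynomial ring. A simple graph is given by its set of edges, which are two-element sets
  of vertices, and an orientation by a set of ordered pairs.
\<close>

definition simple_graph :: "'v set set \<Rightarrow> bool" where
  "simple_graph G \<longleftrightarrow> (\<forall>e\<in>G. card e = 2)"

text \<open>
  For finite \<open>E\<close>, the cardinality condition says that no edge of \<open>G\<close> is directed both ways.
\<close>

definition weighted_oriented_graph ::
    "'v::finite set set \<Rightarrow> ('v \<times> 'v) set \<Rightarrow> ('v \<Rightarrow> nat) \<Rightarrow> bool" where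
  "weighted_oriented_graph G E w \<longleftrightarrow>
     simple_graph G \<and> G = {{i, j} | i j. (i, j) \<in> E} \<and> card E = card G \<and> (\<forall>v. 1 \<le> w v)"

definition is_source :: "('v \<times> 'v) set \<Rightarrow> 'v \<Rightarrow> bool" where
  "is_source E v \<longleftrightarrow> (\<forall>u. (u, v) \<notin> E)"

definition is_sink :: "('v \<times> 'v) set \<Rightarrow> 'v \<Rightarrow> bool" where
  "is_sink E v \<longleftrightarrow> (\<forall>u. (v, u) \<notin> E)"

definition V_plus :: "('v \<Rightarrow> nat) \<Rightarrow> 'v set" where
  "V_plus w = {v. 1 < w v}"

definition is_triangle :: "'v set set \<Rightarrow> 'v set \<Rightarrow> bool" where
  "is_triangle G T \<longleftrightarrow> card T = 3 \<and> (\<forall>u\<in>T. \<forall>v\<in>T. u \<noteq> v \<longrightarrow> {u, v} \<in> G)"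


section \<open>Symbolic powers of ideals in an integral domain\<close>

text \<open>
  Ideals are those of \<^theory>\<open>HOL-Algebra.Ideal\<close>, taken in the ring record
  \<^const>\<open>ring_of_type_algebra\<close>, whose carrier is the whole type. The record
  \<^const>\<open>ideals_set\<close> supplies the multiplicative monoid of ideals, and hence
  \<open>I [^] n\<close> is the ordinary power of an ideal, with \<open>I [^] 0\<close> the unit ideal.
\<close>

definition ideal_power :: "'a::comm_ring_1 set \<Rightarrow> nat \<Rightarrow> 'a set" where
  "ideal_power I n = I [^]\<^bsub>ideals_set (ring_of_type_algebra :: 'a ring)\<^esub> n"

definition minimal_primes :: "'a::comm_ring_1 set \<Rightarrow> 'a set set" where
  "minimal_primes I =
     {P. primeideal P (ring_of_type_algebra :: 'a ring) \<and> I \<subseteq> P \<and>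
         (\<forall>Q. primeideal Q (ring_of_type_algebra :: 'a ring) \<and> I \<subseteq> Q \<and> Q \<subseteq> P \<longrightarrow> Q = P)}"

text \<open>
  The localization at a prime ideal \<open>P\<close> of a domain, as a subring of the fraction field, and
  the embedding of the domain into it.
\<close>

definition localization :: "'a::idom set \<Rightarrow> 'a fract ring" where
  "localization P =
     (ring_of_type_algebra :: 'a fract ring)\<lparr>carrier := {Fract a s | a s. s \<notin> P}\<rparr>"

definition to_localization :: "'a::idom \<Rightarrow> 'a fract" where
  "to_localization f = Fract f 1"

definition symbolic_power :: "'a::idom set \<Rightarrow> nat \<Rightarrow> 'a set" where
  "symbolic_power I n =
     (\<Inter>P\<in>minimal_primes I.
        to_localization -` (Idl\<^bsub>localization P\<^esub> (to_localization ` ideal_power I n)))"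


section \<open>The edge ideal\<close>

text \<open>
  The polynomial ring over \<open>'k\<close> with set of variables \<open>'v\<close>: finitely supported coefficient
  functions on exponent vectors, with the convolution product. A linear order on \<open>'v\<close> has no
  mathematical content; it is what the library uses to show that this ring is a domain.
\<close>

type_synonym ('v, 'k) mpoly = "('v \<Rightarrow>\<^sub>0 nat) \<Rightarrow>\<^sub>0 'k"

definition pvar :: "'v \<Rightarrow> ('v, 'k::comm_ring_1) mpoly" where
  "pvar i = Poly_Mapping.single (Poly_Mapping.single i 1) 1"

definition edge_ideal :: "('v \<times> 'v) set \<Rightarrow> ('v \<Rightarrow> nat) \<Rightarrow> ('v, 'k::field) mpoly set" where
  "edge_ideal E w =
     Idl\<^bsub>(ring_of_type_algebra :: ('v, 'k) mpoly ring)\<^esub> {pvar i * pvar j ^ w j | i j. (i, j) \<in> E}"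

end

theory Submission
  imports Defs
begin

text \<open>
  Everything reduces to monomials, through two descriptions of the two squares. Write \<open>I\<close> for the
  edge ideal and \<open>I\<^sub>Q\<close> for the ideal of all \<open>f\<close> with \<open>s * f \<in> I\<close> for some \<open>s \<notin> Q\<close>. A polynomial lies
  in the ordinary square iff each of its exponent vectors dominates the sum of two edge exponents
  (\<open>edge_ideal_power_2_iff\<close>). It lies in the symbolic square iff for each minimal prime \<open>Q\<close> of \<open>I\<close> it
  is moved into the ordinary square by a factor outside \<open>Q\<close> (\<open>symbolic_power_eq_contractions\<close>).

  Suppose first that one of the two conditions fails. At a minimal prime \<open>Q\<close> every variable
  \<open>t\<^sub>i \<in> Q\<close> has a neighbour \<open>t\<^sub>j \<notin> Q\<close>, as \<open>t\<^sub>i\<close> could be dropped from the vertex cover belonging to \<open>Q\<close>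
  otherwise; inverting \<open>t\<^sub>j\<close> in that edge generator gives \<open>t\<^sub>i ^ w\<^sub>i \<in> I\<^sub>Q\<close>, and even \<open>t\<^sub>i \<in> I\<^sub>Q\<close> if the edge
  points from \<open>i\<close> to \<open>j\<close>. A vertex \<open>v\<close> with \<open>w\<^sub>v > 1\<close> that is not a sink is not a source either, so it
  lies on a directed path \<open>u \<rightarrow> v \<rightarrow> x\<close>, and then \<open>t\<^sub>u * t\<^sub>v ^ w\<^sub>v * t\<^sub>x ^ w\<^sub>x\<close> is in the symbolic square: each
  \<open>I\<^sub>Q\<close> contains two factors whose product divides it. A degree count on the three vertices shows that
  it is not in the ordinary square. If all vertices of weight greater than 1 are sinks, the same works
  for \<open>t\<^sub>x ^ w\<^sub>x * t\<^sub>y ^ w\<^sub>y * t\<^sub>z ^ w\<^sub>z\<close> on a triangle, since each \<open>Q\<close> contains two of its vertices while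
  two edges inside a triangle always share a vertex.

  Conversely, if the vertices of weight greater than 1 are sinks, the generators of \<open>I\<close> are
  \<open>t\<^sub>i ^ w\<^sub>i * t\<^sub>j ^ w\<^sub>j\<close>, so only the quotients \<open>b\<^sub>i = m\<^sub>i div w\<^sub>i\<close> of an exponent vector \<open>m\<close> matter. For a
  minimal vertex cover \<open>C\<close>, membership in the symbolic square forces the sum of the \<open>b\<^sub>i\<close> over \<open>C\<close> to be
  at least 2 (\<open>symbolic_power_cover_degree\<close>, which rests on \<open>contraction_var_prime_upset\<close>), and hence
  this holds for all vertex covers. In a triangle-free graph this inequality produces two edges, possibly
  equal, whose indicator vectors add up to at most \<open>b\<close> (\<open>two_edges_if_cover_degree_ge_2\<close>).
\<close>

section \<open>Ideals in subrings of a type-class ring\<close>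

text \<open>
  The polynomial ring and the localizations inside its fraction field are both of this form, so one
  criterion for being an ideal serves both.
\<close>

abbreviation subring_of :: "'a::comm_ring_1 set \<Rightarrow> 'a ring" where
  "subring_of A \<equiv> (ring_of_type_algebra :: 'a ring)\<lparr>carrier := A\<rparr>"

lemma subring_of_UNIV: "subring_of UNIV = ring_of_type_algebra"
  by (simp add: ring_of_type_algebra_def)

lemma cring_subring_of:
  fixes A :: "'a::comm_ring_1 set"
  assumes "0 \<in> A" "1 \<in> A"
    and "\<And>a b. a \<in> A \<Longrightarrow> b \<in> A \<Longrightarrow> a + b \<in> A"
    and "\<And>a b. a \<in> A \<Longrightarrow> b \<in> A \<Longrightarrow> a * b \<in> A"
    and "\<And>a. a \<in> A \<Longrightarrow> - a \<in> A"
  shows "cring (subring_of A)"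
proof -
  have "\<exists>y\<in>A. x + y = 0" if "x \<in> A" for x
    using assms(5)[OF that] by (intro bexI[of _ "- x"]) auto
  moreover have "\<exists>y\<in>A. y + x = 0" if "x \<in> A" for x
    using assms(5)[OF that] by (intro bexI[of _ "- x"]) auto
  ultimately show ?thesis
    unfolding ring_of_type_algebra_def using assms
    by unfold_locales (auto simp: algebra_simps Units_def add_eq_0_iff2 add_eq_0_iff)
qed

lemma ideal_subring_of_iff:
  fixes A :: "'a::comm_ring_1 set"
  assumes A: "cring (subring_of A)"
  shows "ideal I (subring_of A) \<longleftrightarrow>
    I \<subseteq> A \<and> 0 \<in> I \<and> (\<forall>a\<in>I. \<forall>b\<in>I. a + b \<in> I) \<and> (\<forall>a\<in>I. \<forall>r\<in>A. r * a \<in> I)"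
    (is "?L \<longleftrightarrow> ?R")
proof -
  interpret cring "subring_of A" by (fact A)
  have ops: "\<zero>\<^bsub>subring_of A\<^esub> = 0" "\<one>\<^bsub>subring_of A\<^esub> = 1"
    "\<And>a b. a \<oplus>\<^bsub>subring_of A\<^esub> b = a + b" "\<And>a b. a \<otimes>\<^bsub>subring_of A\<^esub> b = a * b"
    by (simp_all add: ring_of_type_algebra_def)
  show ?thesis
  proof
    assume ?L
    then interpret ideal I "subring_of A" .
    have car: "carrier (subring_of A) = A" by simp
    show ?R
      using a_subset additive_subgroup.zero_closed[OF is_additive_subgroup] a_closed I_l_closed
      unfolding ops car by blast
  next
    assume R: ?R
    have neg: "\<ominus>\<^bsub>subring_of A\<^esub> a = - a" if "a \<in> A" for a
      using r_neg[of a, unfolded ops] that by (simp add: add_eq_0_iff)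
    \<comment> \<open>closure of \<open>I\<close> under negation comes from multiplication by \<open>- 1\<close>\<close>
    have m1: "- 1 \<in> A"
      using neg[of 1] one_closed a_inv_closed[of 1] by (simp add: ops)
    show ?L
    proof (rule idealI)
      show "ring (subring_of A)" ..
      show "subgroup I (add_monoid (subring_of A))"
      proof
        fix x assume x: "x \<in> I"
        have "- x \<in> I" using R x m1 by (metis mult_minus1)
        moreover have "x \<in> A" using R x by auto
        ultimately show "inv\<^bsub>add_monoid (subring_of A)\<^esub> x \<in> I"
          using neg[of x] by (simp add: a_inv_def)
      qed (use R in \<open>auto simp: ring_of_type_algebra_def\<close>)
    qed (use R in \<open>auto simp: ring_of_type_algebra_def mult.commute\<close>)
  qed
qed

lemma ideal_iff:
  fixes I :: "'a::comm_ring_1 set"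
  shows "ideal I (ring_of_type_algebra :: 'a ring) \<longleftrightarrow>
    0 \<in> I \<and> (\<forall>a\<in>I. \<forall>b\<in>I. a + b \<in> I) \<and> (\<forall>a\<in>I. \<forall>r. r * a \<in> I)"
  using ideal_subring_of_iff[of UNIV I] cring_subring_of[of "UNIV :: 'a set"]
  by (simp add: subring_of_UNIV)

lemma primeideal_iff:
  fixes P :: "'a::comm_ring_1 set"
  shows "primeideal P (ring_of_type_algebra :: 'a ring) \<longleftrightarrow>
    ideal P (ring_of_type_algebra :: 'a ring) \<and> 1 \<notin> P \<and> (\<forall>a b. a * b \<in> P \<longrightarrow> a \<in> P \<or> b \<in> P)"
proof -
  have *: "1 \<notin> P \<longleftrightarrow> UNIV \<noteq> P" if "ideal P (ring_of_type_algebra :: 'a ring)"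
    using that unfolding ideal_iff by (metis UNIV_I UNIV_eq_I mult.right_neutral)
  show ?thesis
    unfolding primeideal_def primeideal_axioms_def using * cring_from_type_algebra
    by (auto simp: ring_of_type_algebra_def)
qed

lemma ideal_sum_in:
  fixes I :: "'a::comm_ring_1 set"
  assumes "ideal I (ring_of_type_algebra :: 'a ring)" "\<And>x. x \<in> A \<Longrightarrow> f x \<in> I"
  shows "sum f A \<in> I"
  using assms(2) assms(1)[unfolded ideal_iff] by (induction A rule: infinite_finite_induct) auto

lemma ideal_power_2:
  fixes I :: "'a::comm_ring_1 set"
  assumes "ideal I (ring_of_type_algebra :: 'a ring)"
  shows "ideal_power I 2 = ideal_prod (ring_of_type_algebra :: 'a ring) I I"
proof -
  let ?R = "ring_of_type_algebra :: 'a ring"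
  interpret cring ?R by (rule cring_from_type_algebra)
  interpret M: comm_monoid "ideals_set ?R" by (rule ideals_set_is_comm_monoid)
  have "I \<in> carrier (ideals_set ?R)" using assms by (simp add: ideals_set_def)
  hence "I [^]\<^bsub>ideals_set ?R\<^esub> Suc (Suc 0) = I \<otimes>\<^bsub>ideals_set ?R\<^esub> I"
    by simp
  thus ?thesis by (simp add: ideal_power_def numeral_2_eq_2 ideals_set_def)
qed

lemma ideal_ideal_power:
  fixes I :: "'a::comm_ring_1 set"
  assumes "ideal I (ring_of_type_algebra :: 'a ring)"
  shows "ideal (ideal_power I n) (ring_of_type_algebra :: 'a ring)"
proof -
  let ?R = "ring_of_type_algebra :: 'a ring"
  interpret cring ?R by (rule cring_from_type_algebra)
  interpret M: comm_monoid "ideals_set ?R" by (rule ideals_set_is_comm_monoid)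
  have "I \<in> carrier (ideals_set ?R)" using assms by (simp add: ideals_set_def)
  hence "I [^]\<^bsub>ideals_set ?R\<^esub> n \<in> carrier (ideals_set ?R)" by (rule M.nat_pow_closed)
  thus ?thesis by (simp add: ideal_power_def ideals_set_def)
qed

lemma mult_in_ideal_power_2:
  fixes I :: "'a::comm_ring_1 set"
  assumes "ideal I (ring_of_type_algebra :: 'a ring)" "a \<in> I" "b \<in> I"
  shows "a * b \<in> ideal_power I 2"
  using ideal_prod.prod[of a I b I "ring_of_type_algebra"] assms
  by (simp add: ideal_power_2) (simp add: ring_of_type_algebra_def)


section \<open>Symbolic powers by clearing denominators\<close>

text \<open>
  For a prime \<open>P\<close> this is the preimage of the ideal that \<open>J\<close> generates in the localization at \<open>P\<close>,
  without reference to fractions.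
\<close>

definition contraction :: "'a::comm_ring_1 set \<Rightarrow> 'a set \<Rightarrow> 'a set" where
  "contraction P J = {f. \<exists>s. s \<notin> P \<and> s * f \<in> J}"

text \<open>
  The fractions with numerator in \<open>J\<close> and denominator outside \<open>P\<close> already form an ideal of the
  localization, which is therefore the one generated by \<open>J\<close>; clearing the denominator in
  \<open>f / 1 = g / s\<close> gives \<open>s * f = g\<close>.
\<close>

lemma localization_contraction:
  fixes P J :: "'a::idom set"
  assumes P: "primeideal P (ring_of_type_algebra :: 'a ring)"
    and J: "ideal J (ring_of_type_algebra :: 'a ring)"
  shows "to_localization -` (Idl\<^bsub>localization P\<^esub> (to_localization ` J)) = contraction P J"
proof -
  note P' = P[unfolded primeideal_iff, THEN conjunct2] and PI = P[unfolded primeideal_iff ideal_iff]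
  note J' = J[unfolded ideal_iff]
  define A where "A = {Fract a s | a s. s \<notin> P}"
  have P0: "s \<noteq> 0" if "s \<notin> P" for s using that PI by auto
  have Pm: "s * t \<notin> P" if "s \<notin> P" "t \<notin> P" for s t using that P' by auto
  have P1: "1 \<notin> P" using P' by auto
  have memA: "Fract a s \<in> A" if "s \<notin> P" for a s using that A_def by auto
  have L: "localization P = subring_of A" by (simp add: localization_def A_def)
  have cringA: "cring (subring_of A)"
  proof (rule cring_subring_of)
    show "0 \<in> A" "1 \<in> A" using P1 by (auto simp: Zero_fract_def One_fract_def intro!: memA)
    fix a assume "a \<in> A"
    then obtain x s where a: "a = Fract x s" "s \<notin> P" by (auto simp: A_def)
    show "- a \<in> A" using a by (auto intro: memA)
    fix b assume "b \<in> A"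
    then obtain y t where b: "b = Fract y t" "t \<notin> P" by (auto simp: A_def)
    show "a + b \<in> A" "a * b \<in> A" using a b by (simp_all add: P0 memA Pm)
  qed
  interpret cring "subring_of A" by (fact cringA)
  define K where "K = {Fract g s | g s. g \<in> J \<and> s \<notin> P}"
  have memK: "Fract g s \<in> K" if "g \<in> J" "s \<notin> P" for g s using that K_def by auto
  have ideal_K: "ideal K (subring_of A)"
    unfolding ideal_subring_of_iff[OF cringA]
  proof (intro conjI ballI)
    show "K \<subseteq> A" by (auto simp: K_def A_def)
    show "0 \<in> K" using J' P1 by (auto simp: Zero_fract_def intro!: memK)
    fix a assume "a \<in> K"
    then obtain x s where a: "a = Fract x s" "x \<in> J" "s \<notin> P" by (auto simp: K_def)
    { fix b assume "b \<in> K"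
      then obtain y t where b: "b = Fract y t" "y \<in> J" "t \<notin> P" by (auto simp: K_def)
      have "x * t + y * s \<in> J" using a b J' by (metis mult.commute)
      thus "a + b \<in> K" using a b by (simp add: P0 memK Pm) }
    { fix b assume "b \<in> A"
      then obtain y t where b: "b = Fract y t" "t \<notin> P" by (auto simp: A_def)
      thus "b * a \<in> K" using a J' by (simp add: memK Pm) }
  qed
  have sub: "to_localization ` J \<subseteq> carrier (subring_of A)"
    using P1 by (auto simp: to_localization_def intro!: memA)
  have "Idl\<^bsub>subring_of A\<^esub> (to_localization ` J) = K"
  proof
    show "Idl\<^bsub>subring_of A\<^esub> (to_localization ` J) \<subseteq> K"
      by (rule genideal_minimal[OF ideal_K]) (auto simp: to_localization_def P1 intro!: memK)
    have idl: "ideal (Idl\<^bsub>subring_of A\<^esub> (to_localization ` J)) (subring_of A)"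
      by (rule genideal_ideal[OF sub])
    show "K \<subseteq> Idl\<^bsub>subring_of A\<^esub> (to_localization ` J)"
    proof
      fix a assume "a \<in> K"
      then obtain x s where a: "a = Fract x s" "x \<in> J" "s \<notin> P" by (auto simp: K_def)
      have "Fract 1 s * Fract x 1 \<in> Idl\<^bsub>subring_of A\<^esub> (to_localization ` J)"
        using idl genideal_self[OF sub] memA[of s 1] a
        unfolding ideal_subring_of_iff[OF cringA] to_localization_def by blast
      thus "a \<in> Idl\<^bsub>subring_of A\<^esub> (to_localization ` J)" using a by simp
    qed
  qed
  moreover have "Fract f 1 \<in> K \<longleftrightarrow> (\<exists>s. s \<notin> P \<and> s * f \<in> J)" for f
  proof
    assume "Fract f 1 \<in> K"
    then obtain g s where "Fract f 1 = Fract g s" "g \<in> J" "s \<notin> P" by (auto simp: K_def)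
    thus "\<exists>s. s \<notin> P \<and> s * f \<in> J"
      by (auto simp: eq_fract P0 mult.commute intro!: exI[of _ s])
  next
    assume "\<exists>s. s \<notin> P \<and> s * f \<in> J"
    then obtain s where s: "s \<notin> P" "s * f \<in> J" by blast
    have "Fract f 1 = Fract (s * f) s" using s by (simp add: eq_fract P0)
    thus "Fract f 1 \<in> K" using s by (simp add: memK)
  qed
  ultimately show ?thesis
    unfolding L contraction_def vimage_def to_localization_def by simp
qed

lemma symbolic_power_eq_contractions:
  fixes I :: "'a::idom set"
  assumes "ideal I (ring_of_type_algebra :: 'a ring)"
  shows "symbolic_power I n = (\<Inter>P\<in>minimal_primes I. contraction P (ideal_power I n))"
  unfolding symbolic_power_def
  by (intro INF_cong refl localization_contraction ideal_ideal_power assms)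
     (auto simp: minimal_primes_def)

lemma contraction_superset:
  fixes P J :: "'a::comm_ring_1 set"
  assumes "primeideal P (ring_of_type_algebra :: 'a ring)"
  shows "J \<subseteq> contraction P J"
  using assms by (auto simp: contraction_def primeideal_iff intro!: exI[of _ 1])

lemma contraction_mult:
  fixes P I :: "'a::comm_ring_1 set"
  assumes "primeideal P (ring_of_type_algebra :: 'a ring)"
    and "ideal I (ring_of_type_algebra :: 'a ring)"
    and "f \<in> contraction P I" "g \<in> contraction P I"
  shows "f * g \<in> contraction P (ideal_power I 2)"
proof -
  obtain s t where "s \<notin> P" "t \<notin> P" and st: "s * f \<in> I" "t * g \<in> I"
    using assms(3,4) by (auto simp: contraction_def)
  moreover have "(s * t) * (f * g) \<in> ideal_power I 2"
    using mult_in_ideal_power_2[OF assms(2) st] by (simp add: ac_simps)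
  ultimately show ?thesis
    using assms(1) by (auto simp: contraction_def primeideal_iff)
qed

lemma ideal_contraction:
  fixes P J :: "'a::comm_ring_1 set"
  assumes "primeideal P (ring_of_type_algebra :: 'a ring)"
    and "ideal J (ring_of_type_algebra :: 'a ring)"
  shows "ideal (contraction P J) (ring_of_type_algebra :: 'a ring)"
  unfolding ideal_iff
proof (intro conjI ballI allI)
  show "0 \<in> contraction P J"
    using assms by (auto simp: contraction_def primeideal_iff ideal_iff intro!: exI[of _ 1])
  fix f assume "f \<in> contraction P J"
  then obtain s where s: "s \<notin> P" "s * f \<in> J" by (auto simp: contraction_def)
  { fix g assume "g \<in> contraction P J"
    then obtain t where t: "t \<notin> P" "t * g \<in> J" by (auto simp: contraction_def)
    have "t * (s * f) + s * (t * g) \<in> J" using assms(2) s t by (simp add: ideal_iff)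
    hence "(s * t) * (f + g) \<in> J" by (simp add: algebra_simps)
    moreover have "s * t \<notin> P" using assms(1) s t by (auto simp: primeideal_iff)
    ultimately show "f + g \<in> contraction P J" by (auto simp: contraction_def) }
  fix r
  have "r * (s * f) \<in> J" using assms(2) s by (simp add: ideal_iff)
  hence "s * (r * f) \<in> J" by (simp add: ac_simps)
  thus "r * f \<in> contraction P J" using s by (auto simp: contraction_def)
qed


section \<open>Monomial ideals\<close>

definition monomial :: "('v \<Rightarrow>\<^sub>0 nat) \<Rightarrow> ('v, 'k::field) mpoly" where
  "monomial m = Poly_Mapping.single m 1"

definition monomial_ideal :: "('v \<Rightarrow>\<^sub>0 nat) set \<Rightarrow> ('v, 'k::field) mpoly set" where
  "monomial_ideal A = {f. \<forall>m\<in>Poly_Mapping.keys f. \<exists>a\<in>A. \<exists>c. m = a + c}"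

lemma monomial_mult: "monomial a * monomial b = monomial (a + b)"
  by (simp add: monomial_def mult_single)

lemma pvar_eq_monomial: "pvar i = monomial (Poly_Mapping.single i 1)"
  by (simp add: pvar_def monomial_def)

lemma pvar_power_eq_monomial: "pvar i ^ n = monomial (Poly_Mapping.single i n)"
proof (induction n)
  case 0
  thus ?case by (simp add: monomial_def)
next
  case (Suc n)
  thus ?case by (simp add: pvar_eq_monomial monomial_mult flip: single_add)
qed

lemma monomial_in_monomial_ideal_iff:
  "monomial m \<in> (monomial_ideal A :: ('v, 'k::field) mpoly set) \<longleftrightarrow> (\<exists>a\<in>A. \<exists>c. m = a + c)"
  by (simp add: monomial_ideal_def monomial_def)

text \<open>
  A monomial ideal is given by an upward closed set of exponents. This form is used instead of a set of
  generators when the exponents are cut out by an inequality.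
\<close>

lemma ideal_keys_in_upset:
  fixes U :: "('v \<Rightarrow>\<^sub>0 nat) set"
  assumes "\<And>a c. a \<in> U \<Longrightarrow> c + a \<in> U"
  shows "ideal {f :: ('v, 'k::field) mpoly. Poly_Mapping.keys f \<subseteq> U} ring_of_type_algebra"
  unfolding ideal_iff
proof (intro conjI ballI allI)
  fix f r :: "('v, 'k) mpoly" assume "f \<in> {f. Poly_Mapping.keys f \<subseteq> U}"
  thus "r * f \<in> {f. Poly_Mapping.keys f \<subseteq> U}"
    using keys_mult[of r f] assms by blast
next
  fix f g :: "('v, 'k) mpoly"
  assume "f \<in> {f. Poly_Mapping.keys f \<subseteq> U}" "g \<in> {f. Poly_Mapping.keys f \<subseteq> U}"
  thus "f + g \<in> {f. Poly_Mapping.keys f \<subseteq> U}"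
    using keys_add[of f g] by blast
qed simp

lemma ideal_monomial_ideal:
  "ideal (monomial_ideal A :: ('v, 'k::field) mpoly set) ring_of_type_algebra"
proof -
  have "c + m \<in> {m. \<exists>a\<in>A. \<exists>c. m = a + c}" if "m \<in> {m. \<exists>a\<in>A. \<exists>c. m = a + c}"
    for m c :: "'v \<Rightarrow>\<^sub>0 nat"
    using that by (force simp: add.left_commute)
  from ideal_keys_in_upset[OF this] show ?thesis
    by (simp add: monomial_ideal_def subset_iff Ball_def)
qed

lemma poly_eq_sum_single:
  "f = (\<Sum>m\<in>Poly_Mapping.keys f. Poly_Mapping.single m (Poly_Mapping.lookup f m))"
  by (rule poly_mapping_eqI)
     (simp add: lookup_sum lookup_single when_def in_keys_iff sum.delta)

lemma in_ideal_if_monomials_in_ideal: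
  fixes f :: "('v, 'k::field) mpoly"
  assumes J: "ideal J ring_of_type_algebra" and m: "\<And>m. m \<in> Poly_Mapping.keys f \<Longrightarrow> monomial m \<in> J"
  shows "f \<in> J"
proof -
  have "Poly_Mapping.single m (Poly_Mapping.lookup f m) \<in> J" if "m \<in> Poly_Mapping.keys f" for m
  proof -
    have "Poly_Mapping.single 0 (Poly_Mapping.lookup f m) * monomial m \<in> J"
      using J m[OF that] by (simp add: ideal_iff)
    thus ?thesis by (simp add: monomial_def mult_single)
  qed
  thus ?thesis
    by (subst poly_eq_sum_single) (rule ideal_sum_in[OF J])
qed

lemma monomial_ideal_subset:
  fixes J :: "('v, 'k::field) mpoly set"
  assumes J: "ideal J ring_of_type_algebra" and A: "\<And>a. a \<in> A \<Longrightarrow> monomial a \<in> J"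
  shows "monomial_ideal A \<subseteq> J"
proof
  fix f :: "('v, 'k) mpoly" assume f: "f \<in> monomial_ideal A"
  show "f \<in> J"
  proof (rule in_ideal_if_monomials_in_ideal[OF J])
    fix m assume "m \<in> Poly_Mapping.keys f"
    then obtain a c where "a \<in> A" "m = c + a"
      using f by (auto simp: monomial_ideal_def add.commute)
    thus "monomial m \<in> J"
      using J A by (simp add: ideal_iff flip: monomial_mult)
  qed
qed

lemma monomial_in_monomial_ideal: "a \<in> A \<Longrightarrow> monomial a \<in> monomial_ideal A"
  by (metis add.right_neutral monomial_in_monomial_ideal_iff)

lemma genideal_monomials:
  "Idl\<^bsub>(ring_of_type_algebra :: ('v, 'k::field) mpoly ring)\<^esub> (monomial ` A) = monomial_ideal A"
proof -
  let ?R = "ring_of_type_algebra :: ('v, 'k) mpoly ring"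
  interpret cring "ring_of_type_algebra :: ('v, 'k) mpoly ring"
    by (rule cring_from_type_algebra)
  have car: "carrier (ring_of_type_algebra :: ('v, 'k) mpoly ring) = UNIV"
    by (simp add: ring_of_type_algebra_def)
  show ?thesis
  proof
    show "Idl\<^bsub>?R\<^esub> (monomial ` A) \<subseteq> (monomial_ideal A :: ('v, 'k) mpoly set)"
      by (rule genideal_minimal[OF ideal_monomial_ideal]) (auto intro: monomial_in_monomial_ideal)
    show "(monomial_ideal A :: ('v, 'k) mpoly set) \<subseteq> Idl\<^bsub>?R\<^esub> (monomial ` A)"
      using genideal_ideal[of "monomial ` A"] genideal_self[of "monomial ` A"]
      by (intro monomial_ideal_subset) (auto simp: car)
  qed
qed

text \<open>
  Exponents of a product of two elements are sums of exponents of the factors, so no exponents occur in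
  the square besides the multiples of products of two generators.
\<close>

lemma monomial_ideal_power_2:
  "ideal_power (monomial_ideal A :: ('v, 'k::field) mpoly set) 2 = monomial_ideal {a + b | a b. a \<in> A \<and> b \<in> A}"
    (is "_ = ?M")
proof
  let ?R = "ring_of_type_algebra :: ('v, 'k) mpoly ring"
  show "?M \<subseteq> ideal_power (monomial_ideal A) 2"
    by (rule monomial_ideal_subset)
       (auto simp: ideal_ideal_power ideal_monomial_ideal monomial_in_monomial_ideal
             simp flip: monomial_mult intro!: mult_in_ideal_power_2)
  show "ideal_power (monomial_ideal A) 2 \<subseteq> ?M"
    unfolding ideal_power_2[OF ideal_monomial_ideal]
  proof
    fix f assume "f \<in> ideal_prod ?R (monomial_ideal A) (monomial_ideal A)"
    thus "f \<in> ?M"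
    proof induction
      case (prod f g)
      have "f * g \<in> ?M"
        unfolding monomial_ideal_def
      proof (clarify)
        fix m assume "m \<in> Poly_Mapping.keys (f * g)"
        then obtain p q where pq: "m = p + q" "p \<in> Poly_Mapping.keys f" "q \<in> Poly_Mapping.keys g"
          using keys_mult by blast
        obtain a c where a: "a \<in> A" "p = a + c" using prod pq by (auto simp: monomial_ideal_def)
        obtain b d where b: "b \<in> A" "q = b + d" using prod pq by (auto simp: monomial_ideal_def)
        have "m = (a + b) + (c + d)" using a b pq by (simp add: ac_simps)
        thus "\<exists>a\<in>{a + b | a b. a \<in> A \<and> b \<in> A}. \<exists>c. m = a + c" using a b by blast
      qed
      thus ?case by (simp add: ring_of_type_algebra_def)
    next
      case (sum f g)
      have "f + g \<in> ?M"
        using ideal_monomial_ideal sum.IH unfolding ideal_iff by blast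
      thus ?case by (simp add: ring_of_type_algebra_def)
    qed
  qed
qed

definition edge_exponent :: "('v \<Rightarrow> nat) \<Rightarrow> 'v \<times> 'v \<Rightarrow> ('v \<Rightarrow>\<^sub>0 nat)" where
  "edge_exponent w e = Poly_Mapping.single (fst e) 1 + Poly_Mapping.single (snd e) (w (snd e))"

lemma lookup_edge_exponent:
  "Poly_Mapping.lookup (edge_exponent w (i, j)) v = of_bool (v = i) + of_bool (v = j) * w j"
  by (auto simp: edge_exponent_def lookup_add lookup_single when_def)

lemma edge_generator_eq_monomial: "pvar i * pvar j ^ w j = monomial (edge_exponent w (i, j))"
  unfolding pvar_power_eq_monomial by (simp add: pvar_eq_monomial monomial_mult edge_exponent_def)

lemma edge_ideal_eq_monomial_ideal:
  "(edge_ideal E w :: ('v, 'k::field) mpoly set) = monomial_ideal (edge_exponent w ` E)"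
proof -
  have "{pvar i * pvar j ^ w j | i j. (i, j) \<in> E} =
    (monomial ` edge_exponent w ` E :: ('v, 'k) mpoly set)"
    by (auto simp: edge_generator_eq_monomial)
  thus ?thesis
    by (simp add: edge_ideal_def genideal_monomials)
qed

lemma ideal_edge_ideal: "ideal (edge_ideal E w :: ('v, 'k::field) mpoly set) ring_of_type_algebra"
  by (simp add: edge_ideal_eq_monomial_ideal ideal_monomial_ideal)

lemma edge_generator_in_edge_ideal:
  "(i, j) \<in> E \<Longrightarrow> pvar i * pvar j ^ w j \<in> (edge_ideal E w :: ('v, 'k::field) mpoly set)"
  by (simp add: edge_ideal_eq_monomial_ideal edge_generator_eq_monomial monomial_in_monomial_ideal)

lemma exponent_divides_iff:
  fixes a m :: "'v \<Rightarrow>\<^sub>0 nat"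
  shows "(\<exists>c. m = a + c) \<longleftrightarrow> (\<forall>v. Poly_Mapping.lookup a v \<le> Poly_Mapping.lookup m v)"
proof
  assume "\<forall>v. Poly_Mapping.lookup a v \<le> Poly_Mapping.lookup m v"
  hence "m = a + (m - a)"
    by (intro poly_mapping_eqI) (simp add: lookup_add lookup_minus)
  thus "\<exists>c. m = a + c" ..
qed (auto simp: lookup_add)

lemma edge_ideal_power_2_iff:
  fixes f :: "('v, 'k::field) mpoly"
  shows "f \<in> ideal_power (edge_ideal E w) 2 \<longleftrightarrow>
    (\<forall>m\<in>Poly_Mapping.keys f. \<exists>d\<in>E. \<exists>e\<in>E. \<forall>v.
       Poly_Mapping.lookup (edge_exponent w d) v + Poly_Mapping.lookup (edge_exponent w e) v
         \<le> Poly_Mapping.lookup m v)"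
proof -
  have "(\<exists>a\<in>{a + b | a b. a \<in> edge_exponent w ` E \<and> b \<in> edge_exponent w ` E}. \<exists>c. m = a + c) \<longleftrightarrow>
    (\<exists>d\<in>E. \<exists>e\<in>E. \<forall>v.
       Poly_Mapping.lookup (edge_exponent w d) v + Poly_Mapping.lookup (edge_exponent w e) v
         \<le> Poly_Mapping.lookup m v)" for m :: "'v \<Rightarrow>\<^sub>0 nat"
    unfolding exponent_divides_iff lookup_add[symmetric] by blast
  thus ?thesis
    unfolding edge_ideal_eq_monomial_ideal monomial_ideal_power_2
    unfolding monomial_ideal_def mem_Collect_eq by simp
qed


section \<open>Contraction along a prime generated by variables\<close>

definition var_prime :: "'v set \<Rightarrow> ('v, 'k::field) mpoly set" where
  "var_prime C = {f. \<forall>m\<in>Poly_Mapping.keys f. \<exists>i\<in>C. Poly_Mapping.lookup m i \<noteq> 0}"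

lemma split_poly:
  fixes f :: "('v, 'k::field) mpoly"
  obtains g h where "f = g + h" "Poly_Mapping.keys g = Poly_Mapping.keys f \<inter> U"
    "Poly_Mapping.keys h = Poly_Mapping.keys f - U"
proof
  define g where "g = Poly_Mapping.mapp (\<lambda>m c. if m \<in> U then c else 0) f"
  have l: "Poly_Mapping.lookup g m = (if m \<in> U then Poly_Mapping.lookup f m else 0)" for m
    by (simp add: g_def lookup_mapp when_def in_keys_iff)
  show "f = g + (f - g)" by simp
  show "Poly_Mapping.keys g = Poly_Mapping.keys f \<inter> U"
    by (auto simp: in_keys_iff l split: if_splits)
  show "Poly_Mapping.keys (f - g) = Poly_Mapping.keys f - U"
    by (auto simp: in_keys_iff l lookup_minus split: if_splits)
qed

text \<open>
  An ideal spanned by monomials, in which membership of a monomial depends only on its exponents in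
  \<open>C\<close>, is not enlarged by inverting elements outside the prime generated by the variables of \<open>C\<close>.
  Grade the polynomials by the total degree in \<open>C\<close>. The part of \<open>f\<close> outside the ideal, if nonzero, has
  a component of lowest degree, and \<open>s\<close> has a nonzero component of degree 0. As the ring is a domain,
  the product of these two components is nonzero, and it is the lowest component of the product;
  its exponents agree on \<open>C\<close> with exponents of \<open>f\<close> outside \<open>U\<close>, so they cannot lie in \<open>U\<close>.
\<close>

lemma contraction_var_prime_upset:
  fixes f s :: "('v::{finite,linorder}, 'k::field) mpoly"
  assumes up: "\<And>a c. a \<in> U \<Longrightarrow> c + a \<in> U"
    and dep: "\<And>a c. c + a \<in> U \<Longrightarrow> (\<forall>i\<in>C. Poly_Mapping.lookup c i = 0) \<Longrightarrow> a \<in> U"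
    and s: "s \<notin> var_prime C" and sf: "Poly_Mapping.keys (s * f) \<subseteq> U"
  shows "Poly_Mapping.keys f \<subseteq> U"
proof (rule ccontr)
  assume not: "\<not> Poly_Mapping.keys f \<subseteq> U"
  define deg where "deg m = (\<Sum>i\<in>C. Poly_Mapping.lookup m i)" for m :: "'v \<Rightarrow>\<^sub>0 nat"
  have deg_add: "deg (a + b) = deg a + deg b" for a b
    by (simp add: deg_def lookup_add sum.distrib)
  have deg_0: "deg m = 0 \<longleftrightarrow> (\<forall>i\<in>C. Poly_Mapping.lookup m i = 0)" for m
    by (simp add: deg_def)
  \<comment> \<open>\<open>f2\<close> collects the offending terms; it inherits the hypothesis on \<open>f\<close>\<close>
  obtain f1 f2 where f: "f = f1 + f2" and f1: "Poly_Mapping.keys f1 = Poly_Mapping.keys f \<inter> U"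
    and f2: "Poly_Mapping.keys f2 = Poly_Mapping.keys f - U"
    using split_poly by blast
  have ne: "Poly_Mapping.keys f2 \<noteq> {}" using not f2 by auto
  have "s * f1 \<in> {f. Poly_Mapping.keys f \<subseteq> U}"
    using ideal_keys_in_upset[of U, where 'k = 'k, OF up] f1 by (simp add: ideal_iff)
  moreover have "s * f2 = s * f - s * f1" by (simp add: f algebra_simps)
  ultimately have sf2: "Poly_Mapping.keys (s * f2) \<subseteq> U"
    using sf keys_diff[of "s * f" "s * f1"] by auto
  define d where "d = Min (deg ` Poly_Mapping.keys f2)"
  have "d \<in> deg ` Poly_Mapping.keys f2"
    unfolding d_def using ne by (intro Min_in) auto
  then obtain a0 where a0: "a0 \<in> Poly_Mapping.keys f2" "deg a0 = d"
    by auto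
  have d_le: "d \<le> deg m" if "m \<in> Poly_Mapping.keys f2" for m
    using that by (simp add: d_def)
  \<comment> \<open>\<open>g\<close> and \<open>s1\<close> are the components of lowest degree\<close>
  obtain g h where gh: "f2 = g + h"
    and g: "Poly_Mapping.keys g = Poly_Mapping.keys f2 \<inter> {m. deg m = d}"
    and h: "Poly_Mapping.keys h = Poly_Mapping.keys f2 - {m. deg m = d}"
    using split_poly by blast
  obtain s1 s2 where s12: "s = s1 + s2"
    and s1: "Poly_Mapping.keys s1 = Poly_Mapping.keys s \<inter> {m. deg m = 0}"
    and s2: "Poly_Mapping.keys s2 = Poly_Mapping.keys s - {m. deg m = 0}"
    using split_poly by blast
  have "s1 \<noteq> 0" using s s1 by (auto simp: var_prime_def deg_0)
  moreover have "g \<noteq> 0" using a0 g by auto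
  ultimately have "s1 * g \<noteq> 0" by simp
  then obtain e where e: "e \<in> Poly_Mapping.keys (s1 * g)"
    by (metis all_not_in_conv keys_eq_empty)
  then obtain c a where ca: "e = c + a" "c \<in> Poly_Mapping.keys s1" "a \<in> Poly_Mapping.keys g"
    using keys_mult by blast
  have dege: "deg e = d" using ca s1 g by (auto simp: deg_add)
  have "d < deg m" if m: "m \<in> Poly_Mapping.keys (s1 * h)" for m
  proof -
    obtain p q where "m = p + q" "q \<in> Poly_Mapping.keys h" using m keys_mult by blast
    thus ?thesis using d_le[of q] h by (auto simp: deg_add)
  qed
  hence "e \<notin> Poly_Mapping.keys (s1 * h)" using dege by auto
  moreover have "d < deg m" if m: "m \<in> Poly_Mapping.keys (s2 * f2)" for m
  proof -
    obtain p q where "m = p + q" "p \<in> Poly_Mapping.keys s2" "q \<in> Poly_Mapping.keys f2"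
      using m keys_mult by blast
    thus ?thesis using d_le[of q] s2 by (auto simp: deg_add)
  qed
  hence "e \<notin> Poly_Mapping.keys (s2 * f2)" using dege by auto
  moreover have "s * f2 = s1 * g + (s1 * h + s2 * f2)"
    by (simp add: s12 gh algebra_simps)
  ultimately have "e \<in> Poly_Mapping.keys (s * f2)"
    using e by (simp add: in_keys_iff lookup_add)
  hence "c + a \<in> U" using sf2 ca by auto
  moreover have "\<forall>i\<in>C. Poly_Mapping.lookup c i = 0" using ca s1 by (auto simp: deg_0)
  ultimately have "a \<in> U" by (rule dep)
  thus False using ca g f2 by auto
qed

text \<open>
  Primality is the case of the contraction lemma in which the monomial ideal is the prime itself.
\<close>

lemma primeideal_var_prime:
  "primeideal (var_prime C :: ('v::{finite,linorder}, 'k::field) mpoly set) ring_of_type_algebra"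
  unfolding primeideal_iff
proof (intro conjI allI impI)
  let ?U = "{m :: 'v \<Rightarrow>\<^sub>0 nat. \<exists>i\<in>C. Poly_Mapping.lookup m i \<noteq> 0}"
  have eq: "var_prime C = {f :: ('v, 'k) mpoly. Poly_Mapping.keys f \<subseteq> ?U}"
    by (auto simp: var_prime_def)
  show "ideal (var_prime C :: ('v, 'k) mpoly set) ring_of_type_algebra"
    unfolding eq by (rule ideal_keys_in_upset) (auto simp: lookup_add)
  show "1 \<notin> (var_prime C :: ('v, 'k) mpoly set)"
    by (simp add: var_prime_def)
  fix f g :: "('v, 'k) mpoly" assume fg: "f * g \<in> var_prime C"
  show "f \<in> var_prime C \<or> g \<in> var_prime C"
  proof (rule disjCI)
    assume "g \<notin> var_prime C"
    thus "f \<in> var_prime C"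
      using contraction_var_prime_upset[of ?U C g f] fg
      by (auto simp: eq lookup_add mult.commute)
  qed
qed

lemma pvar_in_var_prime_iff: "pvar i \<in> (var_prime C :: ('v, 'k::field) mpoly set) \<longleftrightarrow> i \<in> C"
  by (auto simp: var_prime_def pvar_def lookup_single when_def)

lemma var_prime_subset_iff:
  fixes Q :: "('v, 'k::field) mpoly set"
  assumes Q: "ideal Q ring_of_type_algebra"
  shows "var_prime C \<subseteq> Q \<longleftrightarrow> (\<forall>i\<in>C. pvar i \<in> Q)"
proof
  assume "var_prime C \<subseteq> Q"
  thus "\<forall>i\<in>C. pvar i \<in> Q" by (auto simp: subset_iff pvar_in_var_prime_iff)
next
  assume C: "\<forall>i\<in>C. pvar i \<in> Q"
  show "var_prime C \<subseteq> Q"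
  proof
    fix f :: "('v, 'k) mpoly" assume f: "f \<in> var_prime C"
    show "f \<in> Q"
    proof (rule in_ideal_if_monomials_in_ideal[OF Q])
      fix m assume "m \<in> Poly_Mapping.keys f"
      then obtain i where i: "i \<in> C" "Poly_Mapping.lookup m i \<noteq> 0"
        using f by (auto simp: var_prime_def)
      have "m = (m - Poly_Mapping.single i 1) + Poly_Mapping.single i 1"
        using i(2) by (intro poly_mapping_eqI) (auto simp: lookup_add lookup_minus lookup_single when_def)
      hence "monomial m = monomial (m - Poly_Mapping.single i 1) * (pvar i :: ('v, 'k) mpoly)"
        unfolding pvar_eq_monomial monomial_mult by (rule arg_cong)
      thus "monomial m \<in> Q" using C i Q by (simp add: ideal_iff)
    qed
  qed
qed


section \<open>Minimal primes of an edge ideal\<close>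

abbreviation adjacent :: "('v \<times> 'v) set \<Rightarrow> 'v \<Rightarrow> 'v \<Rightarrow> bool" where
  "adjacent E i j \<equiv> (i, j) \<in> E \<or> (j, i) \<in> E"

definition vertex_cover :: "('v \<times> 'v) set \<Rightarrow> 'v set \<Rightarrow> bool" where
  "vertex_cover E C \<longleftrightarrow> (\<forall>(i, j)\<in>E. i \<in> C \<or> j \<in> C)"

lemma vertex_coverD: "vertex_cover E C \<Longrightarrow> (i, j) \<in> E \<Longrightarrow> i \<in> C \<or> j \<in> C"
  by (auto simp: vertex_cover_def)

lemma edge_ideal_subset_var_prime:
  assumes "\<And>v. 1 \<le> w v" "vertex_cover E C"
  shows "edge_ideal E w \<subseteq> (var_prime C :: ('v::{finite,linorder}, 'k::field) mpoly set)"
  unfolding edge_ideal_eq_monomial_ideal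
proof (rule monomial_ideal_subset)
  show "ideal (var_prime C :: ('v, 'k) mpoly set) ring_of_type_algebra"
    using primeideal_var_prime unfolding primeideal_iff by blast
  fix a assume "a \<in> edge_exponent w ` E"
  then obtain i j where a: "a = edge_exponent w (i, j)" "(i, j) \<in> E" by auto
  have "i \<in> C \<or> j \<in> C" using vertex_coverD[OF assms(2) a(2)] .
  moreover have "0 < w j" using assms(1)[of j] by simp
  ultimately show "monomial a \<in> (var_prime C :: ('v, 'k) mpoly set)"
    by (auto simp: var_prime_def monomial_def a lookup_edge_exponent)
qed

lemma power_in_primeideal:
  fixes a :: "'a::comm_ring_1"
  assumes "primeideal P (ring_of_type_algebra :: 'a ring)" "a ^ n \<in> P"
  shows "a \<in> P"
  using assms(2) by (induction n) (use assms(1) in \<open>auto simp: primeideal_iff\<close>)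

lemma edge_meets_prime:
  fixes Q :: "('v, 'k::field) mpoly set"
  assumes "primeideal Q ring_of_type_algebra" "edge_ideal E w \<subseteq> Q" "adjacent E i j"
  shows "pvar i \<in> Q \<or> pvar j \<in> Q"
proof -
  have *: "pvar i \<in> Q \<or> pvar j \<in> Q" if "(i, j) \<in> E" for i j
  proof -
    have "pvar i * pvar j ^ w j \<in> Q"
      using edge_generator_in_edge_ideal[OF that] assms(2) by blast
    thus ?thesis
      using assms(1) power_in_primeideal[OF assms(1)] unfolding primeideal_iff by blast
  qed
  show ?thesis using assms(3) *[of i j] *[of j i] by blast
qed

text \<open>
  If all neighbours of \<open>i\<close> were in \<open>Q\<close>, then the vertices of \<open>Q\<close> other than \<open>i\<close> would still cover all
  edges and generate a strictly smaller prime over the edge ideal.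
\<close>

lemma minimal_prime_var_has_neighbour:
  fixes Q :: "('v::{finite,linorder}, 'k::field) mpoly set"
  assumes w: "\<And>v. 1 \<le> w v" and irrefl: "\<And>v. (v, v) \<notin> E"
    and Q: "Q \<in> minimal_primes (edge_ideal E w)" and i: "pvar i \<in> Q"
  obtains j where "adjacent E i j" "pvar j \<notin> Q"
proof -
  have prime: "primeideal Q ring_of_type_algebra" and sub: "edge_ideal E w \<subseteq> Q"
    and min: "\<And>P. primeideal P ring_of_type_algebra \<Longrightarrow> edge_ideal E w \<subseteq> P \<Longrightarrow> P \<subseteq> Q \<Longrightarrow> P = Q"
    using Q by (auto simp: minimal_primes_def)
  have "\<exists>j. adjacent E i j \<and> pvar j \<notin> Q"
  proof (rule ccontr)
    assume none: "\<nexists>j. adjacent E i j \<and> pvar j \<notin> Q"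
    define C where "C = {j. pvar j \<in> Q} - {i}"
    have "vertex_cover E C"
      unfolding vertex_cover_def C_def
      using edge_meets_prime[OF prime sub] none irrefl by auto
    hence "edge_ideal E w \<subseteq> (var_prime C :: ('v, 'k) mpoly set)"
      by (intro edge_ideal_subset_var_prime w)
    moreover have "var_prime C \<subseteq> Q"
      using prime by (subst var_prime_subset_iff) (auto simp: C_def primeideal_iff)
    ultimately have "var_prime C = Q"
      by (intro min primeideal_var_prime)
    hence "i \<in> C" using i by (auto simp: pvar_in_var_prime_iff)
    thus False by (simp add: C_def)
  qed
  thus ?thesis using that by blast
qed

text \<open>
  The variables in any prime over the edge ideal form a vertex cover, so a smaller prime would give
  a smaller cover.
\<close>

lemma var_prime_minimal_prime:
  assumes w: "\<And>v. 1 \<le> w v" and C: "vertex_cover E C"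
    and min: "\<And>C'. C' \<subset> C \<Longrightarrow> \<not> vertex_cover E C'"
  shows "(var_prime C :: ('v::{finite,linorder}, 'k::field) mpoly set) \<in> minimal_primes (edge_ideal E w)"
  unfolding minimal_primes_def
proof (intro CollectI conjI allI impI)
  show "primeideal (var_prime C :: ('v, 'k) mpoly set) ring_of_type_algebra"
    by (rule primeideal_var_prime)
  show "edge_ideal E w \<subseteq> (var_prime C :: ('v, 'k) mpoly set)"
    by (rule edge_ideal_subset_var_prime[OF w C])
  fix Q :: "('v, 'k) mpoly set"
  assume "primeideal Q ring_of_type_algebra \<and> edge_ideal E w \<subseteq> Q \<and> Q \<subseteq> var_prime C"
  hence prime: "primeideal Q ring_of_type_algebra" and sub: "edge_ideal E w \<subseteq> Q"
    and QC: "Q \<subseteq> var_prime C" by auto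
  have "vertex_cover E {i. pvar i \<in> Q}"
    using edge_meets_prime[OF prime sub] by (auto simp: vertex_cover_def)
  moreover have "{i. pvar i \<in> Q} \<subseteq> C"
    using QC by (auto simp: pvar_in_var_prime_iff subset_iff)
  ultimately have "{i. pvar i \<in> Q} = C" using min by blast
  hence "var_prime C \<subseteq> Q"
    using prime by (subst var_prime_subset_iff) (auto simp: primeideal_iff)
  thus "Q = var_prime C" using QC by blast
qed

lemma minimal_vertex_cover_exists:
  fixes C :: "'v::finite set"
  assumes "vertex_cover E C"
  obtains C' where "C' \<subseteq> C" "vertex_cover E C'" "\<And>D. D \<subset> C' \<Longrightarrow> \<not> vertex_cover E D"
proof -
  have "finite {C'. C' \<subseteq> C \<and> vertex_cover E C'}" by simp
  from finite_has_minimal2[OF this, of C] assms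
  obtain C' where C': "C' \<subseteq> C" "vertex_cover E C'"
    and min: "\<And>D. D \<subseteq> C \<Longrightarrow> vertex_cover E D \<Longrightarrow> D \<subseteq> C' \<Longrightarrow> C' = D"
    by auto
  have "\<not> vertex_cover E D" if "D \<subset> C'" for D
    using min[of D] C'(1) that by auto
  thus ?thesis by (rule that[OF C'])
qed


section \<open>Monomials in the symbolic square outside the ordinary square\<close>

lemma tail_in_contraction:
  fixes Q :: "('v, 'k::field) mpoly set"
  assumes "primeideal Q ring_of_type_algebra" "(i, j) \<in> E" "pvar j \<notin> Q"
  shows "pvar i \<in> contraction Q (edge_ideal E w)"
proof -
  have "pvar j ^ w j \<notin> Q" using power_in_primeideal[OF assms(1)] assms(3) by blast
  moreover have "pvar j ^ w j * pvar i \<in> (edge_ideal E w :: ('v, 'k) mpoly set)"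
    using edge_generator_in_edge_ideal[OF assms(2)] by (simp add: mult.commute)
  ultimately show ?thesis by (auto simp: contraction_def)
qed

lemma var_power_in_contraction:
  fixes Q :: "('v::{finite,linorder}, 'k::field) mpoly set"
  assumes w: "\<And>v. 1 \<le> w v" and irrefl: "\<And>v. (v, v) \<notin> E"
    and Q: "Q \<in> minimal_primes (edge_ideal E w)" and i: "pvar i \<in> Q"
  shows "pvar i ^ w i \<in> contraction Q (edge_ideal E w)"
proof -
  have prime: "primeideal Q ring_of_type_algebra"
    using Q by (auto simp: minimal_primes_def)
  obtain j where j: "adjacent E i j" "pvar j \<notin> Q"
    using minimal_prime_var_has_neighbour[OF w irrefl Q i] by blast
  show ?thesis
  proof (cases "(i, j) \<in> E")
    case True
    have "pvar i ^ (w i - 1) * pvar i \<in> contraction Q (edge_ideal E w)"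
      using tail_in_contraction[OF prime True j(2)] ideal_contraction[OF prime ideal_edge_ideal]
      unfolding ideal_iff by blast
    moreover have "0 < w i" using w[of i] by simp
    ultimately show ?thesis by (simp only: power_minus_mult)
  next
    case False
    thus ?thesis
      using j edge_generator_in_edge_ideal[of j i E w] by (auto simp: contraction_def)
  qed
qed

lemma in_symbolic_power_2I:
  fixes f :: "('v::{finite,linorder}, 'k::field) mpoly"
  assumes "\<And>Q. Q \<in> minimal_primes (edge_ideal E w) \<Longrightarrow> primeideal Q ring_of_type_algebra \<Longrightarrow>
     edge_ideal E w \<subseteq> Q \<Longrightarrow>
     \<exists>a b c. f = c * (a * b) \<and> a \<in> contraction Q (edge_ideal E w) \<and> b \<in> contraction Q (edge_ideal E w)"
  shows "f \<in> symbolic_power (edge_ideal E w) 2"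
  unfolding symbolic_power_eq_contractions[OF ideal_edge_ideal]
proof
  fix Q :: "('v, 'k) mpoly set" assume Q: "Q \<in> minimal_primes (edge_ideal E w)"
  hence prime: "primeideal Q ring_of_type_algebra" and sub: "edge_ideal E w \<subseteq> Q"
    by (auto simp: minimal_primes_def)
  then obtain a b c where f: "f = c * (a * b)"
    and "a \<in> contraction Q (edge_ideal E w)" "b \<in> contraction Q (edge_ideal E w)"
    using assms[OF Q] by blast
  hence "a * b \<in> contraction Q (ideal_power (edge_ideal E w) 2)"
    by (intro contraction_mult prime ideal_edge_ideal)
  thus "f \<in> contraction Q (ideal_power (edge_ideal E w) 2)"
    using ideal_contraction[OF prime ideal_ideal_power[OF ideal_edge_ideal]] f
    by (simp add: ideal_iff)
qed

text \<open>
  Two factors in \<open>I\<^sub>Q\<close> are found according to which of \<open>v\<close> and \<open>x\<close> belong to \<open>Q\<close>. If \<open>v\<close> does not, the two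
  edges give \<open>t\<^sub>u\<close> and \<open>t\<^sub>x ^ w\<^sub>x\<close>. If \<open>x\<close> does not, the second edge gives \<open>t\<^sub>v\<close>, and the weight of \<open>v\<close> is
  at least 2, so \<open>t\<^sub>v\<close> can be used twice. If both belong to \<open>Q\<close>, their weighted powers are in \<open>I\<^sub>Q\<close>.
\<close>

lemma path_monomial_in_symbolic_power:
  assumes w: "\<And>v. 1 \<le> w v" and irrefl: "\<And>v. (v, v) \<notin> E"
    and uv: "(u, v) \<in> E" and vx: "(v, x) \<in> E" and wv: "1 < w v"
  shows "pvar u * pvar v ^ w v * pvar x ^ w x \<in>
    symbolic_power (edge_ideal E w :: ('v::{finite,linorder}, 'k::field) mpoly set) 2"
proof (rule in_symbolic_power_2I)
  fix Q :: "('v, 'k) mpoly set"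
  assume Q: "Q \<in> minimal_primes (edge_ideal E w)" and prime: "primeideal Q ring_of_type_algebra"
    and sub: "edge_ideal E w \<subseteq> Q"
  let ?f = "pvar u * pvar v ^ w v * pvar x ^ w x :: ('v, 'k) mpoly"
  let ?K = "contraction Q (edge_ideal E w)"
  note pow = var_power_in_contraction[OF w irrefl Q]
  consider (v) "pvar v \<notin> Q" | (x) "pvar x \<notin> Q" | (vx) "pvar v \<in> Q" "pvar x \<in> Q" by blast
  thus "\<exists>a b c. ?f = c * (a * b) \<and> a \<in> ?K \<and> b \<in> ?K"
  proof cases
    case v
    have "pvar x \<in> Q" using edge_meets_prime[OF prime sub, of v x] vx v by blast
    hence "pvar x ^ w x \<in> ?K" by (rule pow)
    moreover have "pvar u \<in> ?K" by (rule tail_in_contraction[OF prime uv v])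
    moreover have "?f = pvar v ^ w v * (pvar u * pvar x ^ w x)" by (simp add: ac_simps)
    ultimately show ?thesis by blast
  next
    case x
    have "pvar v \<in> ?K" by (rule tail_in_contraction[OF prime vx x])
    moreover obtain n where "w v = n + 2"
      using wv le_Suc_ex[of 2 "w v"] by auto
    hence "?f = (pvar u * pvar v ^ n * pvar x ^ w x) * (pvar v * pvar v)"
      by (simp add: ac_simps)
    ultimately show ?thesis by blast
  next
    case vx
    moreover have "?f = pvar u * (pvar v ^ w v * pvar x ^ w x)" by (simp add: ac_simps)
    ultimately show ?thesis using pow by blast
  qed
qed

text \<open>
  The exponent of \<open>u\<close> is 1, so at most one of two edges whose generators have a product dividing the
  monomial contains \<open>u\<close>. The other one is then the edge from \<open>v\<close> to \<open>x\<close>, which uses up all of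
  \<open>t\<^sub>x ^ w\<^sub>x\<close> and one factor \<open>t\<^sub>v\<close>. What remains of \<open>t\<^sub>v\<close> is too little for the edge from \<open>u\<close>, and
  nothing remains of \<open>t\<^sub>x\<close>.
\<close>

lemma path_monomial_notin_power:
  assumes w: "\<And>v. 1 \<le> w v" and irrefl: "\<And>v. (v, v) \<notin> E"
    and asym: "\<And>i j. (i, j) \<in> E \<Longrightarrow> (j, i) \<notin> E"
    and uv: "(u, v) \<in> E" and vx: "(v, x) \<in> E"
  shows "pvar u * pvar v ^ w v * pvar x ^ w x \<notin>
    ideal_power (edge_ideal E w :: ('v, 'k::field) mpoly set) 2"
proof
  define m where "m = Poly_Mapping.single u 1 + Poly_Mapping.single v (w v) + Poly_Mapping.single x (w x)"
  have f: "pvar u * pvar v ^ w v * pvar x ^ w x = (monomial m :: ('v, 'k) mpoly)"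
    unfolding m_def pvar_power_eq_monomial by (simp add: pvar_eq_monomial monomial_mult)
  have ne: "u \<noteq> v" "v \<noteq> x" "u \<noteq> x" using irrefl asym uv vx by blast+
  have m: "Poly_Mapping.lookup m u = 1" "Poly_Mapping.lookup m v = w v" "Poly_Mapping.lookup m x = w x"
    "\<And>z. z \<notin> {u, v, x} \<Longrightarrow> Poly_Mapping.lookup m z = 0"
    using ne by (auto simp: m_def lookup_add lookup_single when_def)
  assume "pvar u * pvar v ^ w v * pvar x ^ w x \<in>
    ideal_power (edge_ideal E w :: ('v, 'k::field) mpoly set) 2"
  hence "monomial m \<in> ideal_power (edge_ideal E w :: ('v, 'k::field) mpoly set) 2"
    by (simp only: f)
  then obtain i j k l where E: "(i, j) \<in> E" "(k, l) \<in> E"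
    and le: "\<And>z. of_bool (z = i) + of_bool (z = j) * w j + (of_bool (z = k) + of_bool (z = l) * w l)
      \<le> Poly_Mapping.lookup m z"
    unfolding edge_ideal_power_2_iff by (auto simp: monomial_def lookup_edge_exponent)
  have pos: "0 < w z" for z using w[of z] by simp
  have "p \<in> {u, v, x}" if p: "p = i \<or> p = j \<or> p = k \<or> p = l" for p
  proof (rule ccontr)
    assume "p \<notin> {u, v, x}"
    hence "Poly_Mapping.lookup m p = 0" by (rule m(4))
    thus False using le[of p] pos[of j] pos[of l] p by auto
  qed
  hence mem: "i \<in> {u, v, x}" "j \<in> {u, v, x}" "k \<in> {u, v, x}" "l \<in> {u, v, x}" by blast+
  have "i \<noteq> j" "k \<noteq> l" using E irrefl by auto
  note le' = le[of u, unfolded m] le[of v, unfolded m] le[of x, unfolded m]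
  show False
    using mem E le' ne asym[OF uv] asym[OF vx] asym[OF E(1)] \<open>i \<noteq> j\<close> \<open>k \<noteq> l\<close> pos[of u] pos[of v] pos[of x]
    by auto
qed


lemma triangle_monomial_in_symbolic_power:
  assumes w: "\<And>v. 1 \<le> w v" and irrefl: "\<And>v. (v, v) \<notin> E"
    and adj: "adjacent E x y" "adjacent E y z" "adjacent E x z"
  shows "pvar x ^ w x * pvar y ^ w y * pvar z ^ w z \<in>
    symbolic_power (edge_ideal E w :: ('v::{finite,linorder}, 'k::field) mpoly set) 2"
proof (rule in_symbolic_power_2I)
  fix Q :: "('v, 'k) mpoly set"
  assume Q: "Q \<in> minimal_primes (edge_ideal E w)" and prime: "primeideal Q ring_of_type_algebra"
    and sub: "edge_ideal E w \<subseteq> Q"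
  let ?f = "pvar x ^ w x * pvar y ^ w y * pvar z ^ w z :: ('v, 'k) mpoly"
  let ?K = "contraction Q (edge_ideal E w)"
  note pow = var_power_in_contraction[OF w irrefl Q]
  have "?f = pvar z ^ w z * (pvar x ^ w x * pvar y ^ w y)"
    "?f = pvar x ^ w x * (pvar y ^ w y * pvar z ^ w z)"
    "?f = pvar y ^ w y * (pvar x ^ w x * pvar z ^ w z)"
    by (simp_all add: ac_simps)
  moreover have "pvar x \<in> Q \<and> pvar y \<in> Q \<or> pvar y \<in> Q \<and> pvar z \<in> Q \<or> pvar x \<in> Q \<and> pvar z \<in> Q"
    using adj[THEN edge_meets_prime[OF prime sub]] by blast
  ultimately show "\<exists>a b c. ?f = c * (a * b) \<and> a \<in> ?K \<and> b \<in> ?K"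
    using pow by blast
qed

text \<open>
  Two edges inside \<open>{x, y, z}\<close> share a vertex \<open>i\<close>. Since tails have weight 1, every generator of an edge
  at \<open>i\<close> contains \<open>t\<^sub>i ^ w\<^sub>i\<close>, so the product of the two contains twice the available power.
\<close>

lemma triangle_monomial_notin_power:
  assumes w: "\<And>v. 1 \<le> w v" and irrefl: "\<And>v. (v, v) \<notin> E"
    and tail: "\<forall>i j. (i, j) \<in> E \<longrightarrow> w i = 1"
    and ne: "x \<noteq> y" "y \<noteq> z" "x \<noteq> z"
  shows "pvar x ^ w x * pvar y ^ w y * pvar z ^ w z \<notin>
    ideal_power (edge_ideal E w :: ('v, 'k::field) mpoly set) 2"
proof
  define m where "m = Poly_Mapping.single x (w x) + Poly_Mapping.single y (w y) + Poly_Mapping.single z (w z)"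
  have f: "pvar x ^ w x * pvar y ^ w y * pvar z ^ w z = (monomial m :: ('v, 'k) mpoly)"
    unfolding m_def pvar_power_eq_monomial by (simp add: monomial_mult)
  have m: "Poly_Mapping.lookup m x = w x" "Poly_Mapping.lookup m y = w y" "Poly_Mapping.lookup m z = w z"
    "\<And>v. v \<notin> {x, y, z} \<Longrightarrow> Poly_Mapping.lookup m v = 0"
    using ne by (auto simp: m_def lookup_add lookup_single when_def)
  assume "pvar x ^ w x * pvar y ^ w y * pvar z ^ w z \<in>
    ideal_power (edge_ideal E w :: ('v, 'k::field) mpoly set) 2"
  hence "monomial m \<in> ideal_power (edge_ideal E w :: ('v, 'k::field) mpoly set) 2"
    by (simp only: f)
  then obtain i j k l where E: "(i, j) \<in> E" "(k, l) \<in> E"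
    and le: "\<And>v. of_bool (v = i) + of_bool (v = j) * w j + (of_bool (v = k) + of_bool (v = l) * w l)
      \<le> Poly_Mapping.lookup m v"
    unfolding edge_ideal_power_2_iff by (auto simp: monomial_def lookup_edge_exponent)
  have pos: "0 < w v" for v using w[of v] by simp
  have "p \<in> {x, y, z}" if p: "p = i \<or> p = j \<or> p = k \<or> p = l" for p
  proof (rule ccontr)
    assume "p \<notin> {x, y, z}"
    hence "Poly_Mapping.lookup m p = 0" by (rule m(4))
    thus False using le[of p] pos[of j] pos[of l] p by auto
  qed
  hence mem: "i \<in> {x, y, z}" "j \<in> {x, y, z}" "k \<in> {x, y, z}" "l \<in> {x, y, z}" by blast+
  have "i \<noteq> j" "k \<noteq> l" using E irrefl by auto
  note le' = le[of x, unfolded m] le[of y, unfolded m] le[of z, unfolded m]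
  show False
    using mem le' ne tail[rule_format, OF E(1)] tail[rule_format, OF E(2)] \<open>i \<noteq> j\<close> \<open>k \<noteq> l\<close> pos[of x] pos[of y] pos[of z]
    by auto
qed


section \<open>Vertex covers and membership in the ordinary square\<close>

text \<open>
  For a minimal vertex cover \<open>D\<close>, let the order of a monomial be the sum of the quotients
  \<open>m\<^sub>v div w\<^sub>v\<close> over \<open>D\<close>. It is superadditive, and it is at least 1 on each edge generator, because the edge
  meets \<open>D\<close> in a vertex that occurs in it to its full weight. Hence the ordinary square has order at
  least 2. The order depends on the exponents in \<open>D\<close> only, so this bound survives the contraction
  along the minimal prime belonging to \<open>D\<close>.
\<close>

lemma symbolic_power_cover_degree:
  fixes f :: "('v::{finite,linorder}, 'k::field) mpoly"
  assumes w: "\<And>v. 1 \<le> w v" and tail: "\<forall>i j. (i, j) \<in> E \<longrightarrow> w i = 1"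
    and f: "f \<in> symbolic_power (edge_ideal E w) 2"
    and m: "m \<in> Poly_Mapping.keys f" and C: "vertex_cover E C"
  shows "2 \<le> (\<Sum>v\<in>C. Poly_Mapping.lookup m v div w v)"
proof -
  obtain D where D: "D \<subseteq> C" "vertex_cover E D" "\<And>D'. D' \<subset> D \<Longrightarrow> \<not> vertex_cover E D'"
    using minimal_vertex_cover_exists[OF C] by blast
  define ord where "ord m = (\<Sum>v\<in>D. Poly_Mapping.lookup m v div w v)" for m
  have ord_add: "ord a + ord b \<le> ord (a + b)" for a b
    unfolding ord_def sum.distrib[symmetric]
  proof (rule sum_mono)
    fix v
    show "Poly_Mapping.lookup a v div w v + Poly_Mapping.lookup b v div w v
        \<le> Poly_Mapping.lookup (a + b) v div w v"
      unfolding lookup_add by (subst div_add1_eq) simp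
  qed
  have "(var_prime D :: ('v, 'k) mpoly set) \<in> minimal_primes (edge_ideal E w)"
    by (rule var_prime_minimal_prime[OF w D(2,3)])
  then obtain s where s: "s \<notin> var_prime D" and sf: "s * f \<in> ideal_power (edge_ideal E w) 2"
    using f unfolding symbolic_power_eq_contractions[OF ideal_edge_ideal]
    by (auto simp: contraction_def)
  have ord_edge: "1 \<le> ord (edge_exponent w e)" if e: "e \<in> E" for e
  proof -
    obtain i j where ij: "e = (i, j)" by force
    obtain v where v: "v \<in> D" "v = i \<or> v = j" using vertex_coverD[OF D(2)] e ij by blast
    have "w v \<le> Poly_Mapping.lookup (edge_exponent w e) v"
      using v tail e ij by (auto simp: lookup_edge_exponent)
    hence "1 \<le> Poly_Mapping.lookup (edge_exponent w e) v div w v"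
      using w[of v] by (simp add: Suc_le_eq div_greater_zero_iff)
    also have "\<dots> \<le> ord (edge_exponent w e)"
      unfolding ord_def using v(1) by (intro member_le_sum) auto
    finally show ?thesis .
  qed
  have "Poly_Mapping.keys f \<subseteq> {m. 2 \<le> ord m}"
  proof (rule contraction_var_prime_upset[OF _ _ s])
    fix a c assume "a \<in> {m. 2 \<le> ord m}"
    thus "c + a \<in> {m. 2 \<le> ord m}" using ord_add[of c a] by simp
  next
    fix a c assume "c + a \<in> {m. 2 \<le> ord m}" and "\<forall>i\<in>D. Poly_Mapping.lookup c i = 0"
    thus "a \<in> {m. 2 \<le> ord m}" by (simp add: ord_def lookup_add)
  next
    show "Poly_Mapping.keys (s * f) \<subseteq> {m. 2 \<le> ord m}"
    proof
      fix m assume "m \<in> Poly_Mapping.keys (s * f)"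
      then obtain d e where de: "d \<in> E" "e \<in> E" and
        "\<forall>v. Poly_Mapping.lookup (edge_exponent w d + edge_exponent w e) v \<le> Poly_Mapping.lookup m v"
        using sf unfolding edge_ideal_power_2_iff lookup_add by blast
      then obtain c where "m = edge_exponent w d + edge_exponent w e + c"
        unfolding exponent_divides_iff[symmetric] by blast
      thus "m \<in> {m. 2 \<le> ord m}"
        using ord_edge[OF de(1)] ord_edge[OF de(2)]
          ord_add[of "edge_exponent w d" "edge_exponent w e"]
          ord_add[of "edge_exponent w d + edge_exponent w e" c] by simp
    qed
  qed
  hence "2 \<le> ord m" using m by blast
  also have "ord m \<le> (\<Sum>v\<in>C. Poly_Mapping.lookup m v div w v)"
    unfolding ord_def by (rule sum_mono2) (use D(1) in auto)
  finally show ?thesis .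
qed

text \<open>
  Removing from the support of \<open>b\<close> a set of total weight less than 2 leaves an edge, since the removed
  set together with the complement of the support is not a cover. This gives an edge \<open>{i, j}\<close> in the
  support. If \<open>b\<close> is at least 2 at both ends, the edge is used twice. Otherwise \<open>b\<close> is 1 at one end, say
  \<open>i\<close>, and there is an edge in the support avoiding \<open>i\<close>. It is disjoint from \<open>{i, j}\<close>, or it meets it in
  \<open>j\<close>. In the second case, if \<open>b\<close> is 1 at \<open>j\<close> too, an edge avoiding \<open>j\<close> exists as well; if that one meets
  \<open>{i, j}\<close> in \<open>i\<close>, the two new edges are disjoint, as a common end would close a triangle.
\<close>

lemma two_edges_if_cover_degree_ge_2:
  fixes b :: "'v::finite \<Rightarrow> nat"
  assumes irrefl: "\<And>v. (v, v) \<notin> E"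
    and no_triangle: "\<nexists>x y z. adjacent E x y \<and> adjacent E y z \<and> adjacent E x z"
    and cover: "\<forall>C. vertex_cover E C \<longrightarrow> 2 \<le> sum b C"
  obtains i j k l where "(i, j) \<in> E" "(k, l) \<in> E"
    "\<And>v. of_bool (v = i) + of_bool (v = j) + of_bool (v = k) + of_bool (v = l) \<le> b v"
proof -
  \<comment> \<open>The orientation of the edges does not matter for \<open>good\<close>, so it is restored only at the end.\<close>
  define good where "good i j k l \<longleftrightarrow>
    (\<forall>v. of_bool (v = i) + of_bool (v = j) + of_bool (v = k) + of_bool (v = l) \<le> b v)" for i j k l
  let ?adj = "\<lambda>i j. adjacent E i j"
  have irrefl': "i \<noteq> j" if "?adj i j" for i j using that irrefl by auto
  have edge: "\<exists>p q. ?adj p q \<and> p \<notin> D \<and> q \<notin> D \<and> 0 < b p \<and> 0 < b q"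
    if "sum b D < 2" for D
  proof -
    have "sum b ({v. b v = 0} \<union> D) = sum b D"
      by (rule sum.mono_neutral_right) auto
    hence "\<not> vertex_cover E ({v. b v = 0} \<union> D)" using cover that by fastforce
    thus ?thesis by (auto simp: vertex_cover_def)
  qed
  obtain i j where ij: "?adj i j" "0 < b i" "0 < b j"
    using edge[of "{}"] by auto
  have *: "\<exists>i j k l. ?adj i j \<and> ?adj k l \<and> good i j k l"
    if ij: "?adj i j" "0 < b i" "0 < b j" and bi: "b i < 2" for i j
  proof -
    obtain p q where pq: "?adj p q" "p \<noteq> i" "q \<noteq> i" "0 < b p" "0 < b q"
      using edge[of "{i}"] bi by auto
    show ?thesis
    proof (cases "p \<noteq> j \<and> q \<noteq> j")
      case True
      hence "good i j p q" using ij pq irrefl'[OF ij(1)] irrefl'[OF pq(1)] by (auto simp: good_def)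
      thus ?thesis using ij pq by blast
    next
      case False
      then obtain l where l: "?adj j l" "l \<noteq> i" "0 < b l" using pq by blast
      show ?thesis
      proof (cases "2 \<le> b j")
        case True
        hence "good i j j l" using ij l irrefl'[OF ij(1)] irrefl'[OF l(1)] by (auto simp: good_def)
        thus ?thesis using ij l by blast
      next
        case bj: False
        obtain p q where pq: "?adj p q" "p \<noteq> j" "q \<noteq> j" "0 < b p" "0 < b q"
          using edge[of "{j}"] bj by auto
        show ?thesis
        proof (cases "p \<noteq> i \<and> q \<noteq> i")
          case True
          hence "good i j p q" using ij pq irrefl'[OF ij(1)] irrefl'[OF pq(1)] by (auto simp: good_def)
          thus ?thesis using ij pq by blast
        next
          case False
          then obtain k where k: "?adj i k" "k \<noteq> j" "0 < b k" using pq by blast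
          have "k \<noteq> l" using no_triangle ij l k by blast
          hence "good i k j l"
            using ij l k irrefl'[OF ij(1)] irrefl'[OF l(1)] irrefl'[OF k(1)] by (auto simp: good_def)
          thus ?thesis using k l by blast
        qed
      qed
    qed
  qed
  have "\<exists>i j k l. ?adj i j \<and> ?adj k l \<and> good i j k l"
  proof (cases "2 \<le> b i \<and> 2 \<le> b j")
    case True
    hence "good i j i j" using irrefl'[OF ij(1)] by (auto simp: good_def)
    thus ?thesis using ij by blast
  next
    case False
    thus ?thesis using *[of i j] *[of j i] ij by fastforce
  qed
  then obtain i j k l where g: "?adj i j" "?adj k l" "good i j k l" by blast
  have swap: "good j i k l \<longleftrightarrow> good i j k l" "good i j l k \<longleftrightarrow> good i j k l" for i j k l
    by (simp_all add: good_def ac_simps)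
  have "\<exists>i j k l. (i, j) \<in> E \<and> (k, l) \<in> E \<and> good i j k l"
    using g swap by blast
  thus ?thesis using that unfolding good_def by blast
qed

lemma symbolic_power_2_subset_power:
  assumes w: "\<And>v. 1 \<le> w v" and irrefl: "\<And>v. (v, v) \<notin> E"
    and tail: "\<forall>i j. (i, j) \<in> E \<longrightarrow> w i = 1"
    and no_triangle: "\<nexists>x y z. adjacent E x y \<and> adjacent E y z \<and> adjacent E x z"
  shows "symbolic_power (edge_ideal E w :: ('v::{finite,linorder}, 'k::field) mpoly set) 2
    \<subseteq> ideal_power (edge_ideal E w) 2"
proof
  fix f :: "('v, 'k) mpoly" assume f: "f \<in> symbolic_power (edge_ideal E w) 2"
  show "f \<in> ideal_power (edge_ideal E w) 2"
    unfolding edge_ideal_power_2_iff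
  proof
    fix m assume m: "m \<in> Poly_Mapping.keys f"
    define b where "b v = Poly_Mapping.lookup m v div w v" for v
    have "\<forall>C. vertex_cover E C \<longrightarrow> 2 \<le> sum b C"
      unfolding b_def using symbolic_power_cover_degree[OF w tail f m] by blast
    from two_edges_if_cover_degree_ge_2[OF irrefl no_triangle this]
    obtain i j k l where E: "(i, j) \<in> E" "(k, l) \<in> E"
      and le: "\<And>v. of_bool (v = i) + of_bool (v = j) + of_bool (v = k) + of_bool (v = l) \<le> b v"
      by blast
    have "Poly_Mapping.lookup (edge_exponent w (i, j)) v + Poly_Mapping.lookup (edge_exponent w (k, l)) v
        \<le> Poly_Mapping.lookup m v" for v
    proof -
      have "Poly_Mapping.lookup (edge_exponent w (i, j)) v + Poly_Mapping.lookup (edge_exponent w (k, l)) v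
        = (of_bool (v = i) + of_bool (v = j) + of_bool (v = k) + of_bool (v = l)) * w v"
        using tail[rule_format, OF E(1)] tail[rule_format, OF E(2)] by (auto simp: lookup_edge_exponent)
      also have "\<dots> \<le> b v * w v" using le[of v] by (rule mult_le_mono1)
      also have "\<dots> \<le> Poly_Mapping.lookup m v" by (simp add: b_def)
      finally show ?thesis .
    qed
    thus "\<exists>d\<in>E. \<exists>e\<in>E. \<forall>v. Poly_Mapping.lookup (edge_exponent w d) v
        + Poly_Mapping.lookup (edge_exponent w e) v \<le> Poly_Mapping.lookup m v"
      using E by blast
  qed
qed

section \<open>Equality of the two squares\<close>

text \<open>
  The last conclusion comes from \<open>card E = card G\<close>: forgetting the direction maps \<open>E\<close> onto \<open>G\<close>, hence
  injectively.
\<close>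

lemma weighted_oriented_graphD:
  assumes "weighted_oriented_graph G E w"
  shows "1 \<le> w v" "(v, v) \<notin> E" "{i, j} \<in> G \<longleftrightarrow> adjacent E i j" "(i, j) \<in> E \<Longrightarrow> (j, i) \<notin> E"
proof -
  have G: "G = (\<lambda>(i, j). {i, j}) ` E" and card2: "\<And>e. e \<in> G \<Longrightarrow> card e = 2"
    and card: "card E = card G"
    using assms by (auto simp: weighted_oriented_graph_def simple_graph_def)
  show "1 \<le> w v" using assms by (simp add: weighted_oriented_graph_def)
  show loop: "(v, v) \<notin> E" for v using card2[of "{v}"] by (force simp: G)
  show "{i, j} \<in> G \<longleftrightarrow> adjacent E i j"
    by (force simp: G doubleton_eq_iff)
  have inj: "inj_on (\<lambda>(i, j). {i, j}) E"
    using card by (intro eq_card_imp_inj_on) (auto simp: G)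
  assume ij: "(i, j) \<in> E"
  show "(j, i) \<notin> E"
  proof
    assume "(j, i) \<in> E"
    hence "(i, j) = (j, i)" using inj_onD[OF inj _ ij, of "(j, i)"] by auto
    hence "i = j" by (rule Pair_inject)
    thus False using ij loop[of j] by simp
  qed
qed

theorem theorem3p2:
  fixes G :: "'v::{finite,linorder} set set"
    and E :: "('v \<times> 'v) set"
    and w :: "'v \<Rightarrow> nat"
  assumes "weighted_oriented_graph G E w"
    and "\<And>v. is_source E v \<Longrightarrow> w v = 1"
  shows "ideal_power (edge_ideal E w :: ('v, 'k::field) mpoly set) 2
           = symbolic_power (edge_ideal E w :: ('v, 'k) mpoly set) 2
         \<longleftrightarrow> (\<forall>v\<in>V_plus w. is_sink E v) \<and> (\<nexists>T. is_triangle G T)"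
proof -
  note w = weighted_oriented_graphD(1)[OF assms(1)]
  note irrefl = weighted_oriented_graphD(2)[OF assms(1)]
  note G = weighted_oriented_graphD(3)[OF assms(1)]
  note asym = weighted_oriented_graphD(4)[OF assms(1)]
  let ?I = "edge_ideal E w :: ('v, 'k) mpoly set"
  have tail: "\<forall>i j. (i, j) \<in> E \<longrightarrow> w i = 1" if sinks: "\<forall>v\<in>V_plus w. is_sink E v"
  proof (intro allI impI)
    fix i j assume "(i, j) \<in> E"
    hence "\<not> 1 < w i" using sinks by (auto simp: V_plus_def is_sink_def)
    thus "w i = 1" using w[of i] by simp
  qed
  have triangle: "(\<exists>T. is_triangle G T) \<longleftrightarrow>
    (\<exists>x y z. adjacent E x y \<and> adjacent E y z \<and> adjacent E x z)"
  proof
    assume "\<exists>T. is_triangle G T"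
    then obtain x y z where "x \<noteq> y" "y \<noteq> z" "x \<noteq> z" "is_triangle G {x, y, z}"
      by (auto simp: is_triangle_def card_3_iff)
    hence "adjacent E x y" "adjacent E y z" "adjacent E x z"
      by (auto simp: is_triangle_def simp flip: G)
    thus "\<exists>x y z. adjacent E x y \<and> adjacent E y z \<and> adjacent E x z" by blast
  next
    assume "\<exists>x y z. adjacent E x y \<and> adjacent E y z \<and> adjacent E x z"
    then obtain x y z where xyz: "adjacent E x y" "adjacent E y z" "adjacent E x z" by blast
    hence "x \<noteq> y" "y \<noteq> z" "x \<noteq> z" using irrefl by auto
    hence "is_triangle G {x, y, z}" using xyz by (auto simp: is_triangle_def G)
    thus "\<exists>T. is_triangle G T" ..
  qed
  show ?thesis
  proof (intro iffI conjI)
    assume eq: "ideal_power ?I 2 = symbolic_power ?I 2"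
    show sinks: "\<forall>v\<in>V_plus w. is_sink E v"
    proof
      fix v assume v: "v \<in> V_plus w"
      show "is_sink E v"
      proof (rule ccontr)
        assume "\<not> is_sink E v"
        then obtain x where vx: "(v, x) \<in> E" by (auto simp: is_sink_def)
        have "\<not> is_source E v" using v assms(2)[of v] by (auto simp: V_plus_def)
        then obtain u where uv: "(u, v) \<in> E" by (auto simp: is_source_def)
        have "1 < w v" using v by (simp add: V_plus_def)
        from path_monomial_in_symbolic_power[where 'k = 'k and w = w, OF w irrefl uv vx this] eq
          path_monomial_notin_power[where 'k = 'k and w = w, OF w irrefl asym uv vx]
        show False by simp
      qed
    qed
    show "\<nexists>T. is_triangle G T"
    proof
      assume "\<exists>T. is_triangle G T"
      then obtain x y z where xyz: "adjacent E x y" "adjacent E y z" "adjacent E x z"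
        unfolding triangle by blast
      hence "x \<noteq> y" "y \<noteq> z" "x \<noteq> z" using irrefl by auto
      from triangle_monomial_notin_power[where 'k = 'k and w = w, OF w irrefl tail[OF sinks] this] eq
        triangle_monomial_in_symbolic_power[where 'k = 'k and w = w, OF w irrefl xyz]
      show False by simp
    qed
  next
    assume r: "(\<forall>v\<in>V_plus w. is_sink E v) \<and> (\<nexists>T. is_triangle G T)"
    have "ideal_power ?I 2 \<subseteq> symbolic_power ?I 2"
      unfolding symbolic_power_eq_contractions[OF ideal_edge_ideal]
      by (intro INF_greatest contraction_superset) (simp add: minimal_primes_def)
    moreover have "symbolic_power ?I 2 \<subseteq> ideal_power ?I 2"
      using r triangle by (intro symbolic_power_2_subset_power w irrefl tail) auto
    ultimately show "ideal_power ?I 2 = symbolic_power ?I 2" by (rule equalityI)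
  qed
qed

end
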